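(* Let $P$ be a set of size $n$ and let $v^\star=f(P)$ be an unknown quantity for a non-negative function $f$. Suppose we are given a parameter $\varepsilon\in(0,1)$, an interval $[\alpha,\beta]$ with $\beta>\alpha>0$ containing $v^\star$, and a stable $(1+\tau)$-decider for $v^\star$ that runs in $T(n,1+\tau)$ time and works for any $\tau>0$. Then one can compute an interval $I$ containing $v^\star$ whose spread is at most $1+\varepsilon$ (i.e., a $(1+\varepsilon)$-approximation to $v^\star$), in running time $$O\!\left(T(n,1+\varepsilon)+T(n,2)\,\log\log\tfrac{\beta}{\alpha}\right).$$
   Context: Decider: for a parameter $\tau>0$, a procedure $\mathtt{decider}(P,r,1+\tau)$ is a $(1+\tau)$-decider for $v^\star=f(P)$ if, for every $r>0$, it returns one of the following (correct) answers: (i) an interval $[\alpha',(1+\tau)\alpha']$, for some real number $\alpha'$, that contains $v^\star$; (ii) "$v^\star<r$"; or (iii) "$v^\star>r$". Its running time on inputs of size $n$ is denoted $T(n,1+\tau)$. Stable: the decider is stable if there is a constant $\kappa>0$ such that for all $\tau>\varepsilon'>0$, $$\frac{T(n,1+\varepsilon')}{T(n,1+\tau)}=\Omega\!\left(\Bigl(\frac{\tau}{\varepsilon'(\tau+1)}\Bigr)^{\kappa}\right),$$ with a uniform implied constant. Spread: for an interval $I=[a,b]$ with $b\ge a>0$, its spread is $b/a$. Conventions: $\log\log\frac\beta\alpha$ in the bound is understood to be non-negative (read as $0$ when $\beta/\alpha$ is at most a constant such as $2$); arithmetic operations, including square roots, take constant time, and each decider call takes at least constant time. *)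

theory Defs
  imports Complex_Main
begin

text \<open>
  The answer \<open>Interval a\<close> of a call with parameter \<open>1 + \<tau>\<close> stands for the interval
  \<open>[a, (1 + \<tau>) a]\<close>; \<open>Smaller\<close> and \<open>Larger\<close> stand for \<open>v < r\<close> and \<open>v > r\<close>.
\<close>

datatype answer = Interval real | Smaller | Larger

text \<open>
  A procedure, called with a set \<open>P\<close>, a threshold \<open>r\<close> and the parameter \<open>q = 1 + \<tau>\<close> (and not
  \<open>\<tau>\<close>), yields its answer together with the running time of that call.
\<close>

type_synonym 'a procedure = "'a set \<Rightarrow> real \<Rightarrow> real \<Rightarrow> answer \<times> real"

fun correct_answer :: "real \<Rightarrow> real \<Rightarrow> real \<Rightarrow> answer \<Rightarrow> bool" where
  "correct_answer v r q (Interval a) \<longleftrightarrow> v \<in> {a..q * a}"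
| "correct_answer v r q Smaller \<longleftrightarrow> v < r"
| "correct_answer v r q Larger \<longleftrightarrow> v > r"

definition decider_for :: "'a procedure \<Rightarrow> 'a set \<Rightarrow> real \<Rightarrow> real \<Rightarrow> bool" where
  "decider_for D P v q \<longleftrightarrow> (\<forall>r>0. correct_answer v r q (fst (D P r q)))"

text \<open>\<open>T n q\<close> is the time bound \<open>T(n, q)\<close>, again with \<open>q = 1 + \<tau>\<close>.\<close>

definition stable :: "(nat \<Rightarrow> real \<Rightarrow> real) \<Rightarrow> bool" where
  "stable T \<longleftrightarrow>
    (\<exists>\<kappa>>0. \<exists>c>0. \<forall>n \<tau> \<epsilon>'. 0 < \<epsilon>' \<and> \<epsilon>' < \<tau> \<longrightarrow>
       T n (1 + \<epsilon>') / T n (1 + \<tau>) \<ge> c * (\<tau> / (\<epsilon>' * (\<tau> + 1))) powr \<kappa>)"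

definition spread :: "real \<Rightarrow> real \<Rightarrow> real" where
  "spread a b = b / a"

text \<open>Truncated at 0; for \<open>x > 1\<close> it vanishes exactly when \<open>x \<le> 2\<close>.\<close>

definition loglog :: "real \<Rightarrow> real" where
  "loglog x = max 0 (log 2 (log 2 x))"

text \<open>
  The model of computation is a while language over real registers (a real RAM). A program
  has access to the input set only through calls to the decider. Each arithmetic
  operation (including square roots), comparison, register access and control step
  costs one time unit; a decider call costs in addition the running time of that call.
\<close>

type_synonym state = "nat \<Rightarrow> real"

datatype aexp =
    Num int
  | Reg nat
  | Plus aexp aexp
  | Minus aexp aexp
  | Times aexp aexp
  | Divide aexp aexp
  | Sqrt aexp

datatype bexp = Less aexp aexp

text \<open>
  \<open>Decide r q x c1 c2 c3\<close> calls the decider with the values of \<open>r\<close> and \<open>q\<close>. On \<open>Interval a\<close> it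
  stores \<open>a\<close> in register \<open>x\<close> and continues with \<open>c1\<close>; on \<open>Smaller\<close> it continues with \<open>c2\<close> and
  on \<open>Larger\<close> with \<open>c3\<close>.
\<close>

datatype com =
    Skip
  | Assign nat aexp
  | Seq com com
  | Cond bexp com com
  | While bexp com
  | Decide aexp aexp nat com com com

fun aval :: "aexp \<Rightarrow> state \<Rightarrow> real" where
  "aval (Num k) s = of_int k"
| "aval (Reg x) s = s x"
| "aval (Plus a b) s = aval a s + aval b s"
| "aval (Minus a b) s = aval a s - aval b s"
| "aval (Times a b) s = aval a s * aval b s"
| "aval (Divide a b) s = aval a s / aval b s"
| "aval (Sqrt a) s = sqrt (aval a s)"

fun atime :: "aexp \<Rightarrow> real" where
  "atime (Num k) = 1"
| "atime (Reg x) = 1"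
| "atime (Plus a b) = 1 + atime a + atime b"
| "atime (Minus a b) = 1 + atime a + atime b"
| "atime (Times a b) = 1 + atime a + atime b"
| "atime (Divide a b) = 1 + atime a + atime b"
| "atime (Sqrt a) = 1 + atime a"

fun bval :: "bexp \<Rightarrow> state \<Rightarrow> bool" where
  "bval (Less a b) s \<longleftrightarrow> aval a s < aval b s"

fun btime :: "bexp \<Rightarrow> real" where
  "btime (Less a b) = 1 + atime a + atime b"

text \<open>
  \<open>exec d c s t s'\<close>: with decider \<open>d\<close>, the program \<open>c\<close> started in \<open>s\<close> terminates in \<open>s'\<close>
  after time \<open>t\<close>. A decider call outside its domain \<open>r > 0\<close>, \<open>q > 1\<close> gets stuck.
  By determinism below, the existence of an execution is the same as termination with
  that result.
\<close>

inductive exec ::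
  "(real \<Rightarrow> real \<Rightarrow> answer \<times> real) \<Rightarrow> com \<Rightarrow> state \<Rightarrow> real \<Rightarrow> state \<Rightarrow> bool"
  for d where
  exec_Skip: "exec d Skip s 1 s"
| exec_Assign: "exec d (Assign x a) s (1 + atime a) (s(x := aval a s))"
| exec_Seq: "exec d c1 s t1 s' \<Longrightarrow> exec d c2 s' t2 s'' \<Longrightarrow> exec d (Seq c1 c2) s (t1 + t2) s''"
| exec_CondT: "bval b s \<Longrightarrow> exec d c1 s t s' \<Longrightarrow> exec d (Cond b c1 c2) s (1 + btime b + t) s'"
| exec_CondF: "\<not> bval b s \<Longrightarrow> exec d c2 s t s' \<Longrightarrow> exec d (Cond b c1 c2) s (1 + btime b + t) s'"
| exec_WhileF: "\<not> bval b s \<Longrightarrow> exec d (While b c) s (1 + btime b) s"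
| exec_WhileT: "bval b s \<Longrightarrow> exec d c s t1 s' \<Longrightarrow> exec d (While b c) s' t2 s'' \<Longrightarrow>
    exec d (While b c) s (1 + btime b + t1 + t2) s''"
| exec_Interval: "0 < aval r s \<Longrightarrow> 1 < aval q s \<Longrightarrow>
    d (aval r s) (aval q s) = (Interval a, t0) \<Longrightarrow> exec d c1 (s(x := a)) t s' \<Longrightarrow>
    exec d (Decide r q x c1 c2 c3) s (1 + atime r + atime q + t0 + t) s'"
| exec_Smaller: "0 < aval r s \<Longrightarrow> 1 < aval q s \<Longrightarrow>
    d (aval r s) (aval q s) = (Smaller, t0) \<Longrightarrow> exec d c2 s t s' \<Longrightarrow>
    exec d (Decide r q x c1 c2 c3) s (1 + atime r + atime q + t0 + t) s'"
| exec_Larger: "0 < aval r s \<Longrightarrow> 1 < aval q s \<Longrightarrow>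
    d (aval r s) (aval q s) = (Larger, t0) \<Longrightarrow> exec d c3 s t s' \<Longrightarrow>
    exec d (Decide r q x c1 c2 c3) s (1 + atime r + atime q + t0 + t) s'"

inductive_cases exec_SkipE: "exec d Skip s t s'"
inductive_cases exec_AssignE: "exec d (Assign x a) s t s'"
inductive_cases exec_SeqE: "exec d (Seq c1 c2) s t s'"
inductive_cases exec_CondE: "exec d (Cond b c1 c2) s t s'"
inductive_cases exec_WhileE: "exec d (While b c) s t s'"
inductive_cases exec_DecideE: "exec d (Decide r q x c1 c2 c3) s t s'"

lemma exec_deterministic:
  "exec d c s t s' \<Longrightarrow> exec d c s u s'' \<Longrightarrow> u = t \<and> s'' = s'"
proof (induction arbitrary: u s'' rule: exec.induct)
  case exec_Skip
  then show ?case by (rule exec_SkipE) simp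
next
  case exec_Assign
  then show ?case by (rule exec_AssignE) simp
next
  case (exec_Seq c1 s t1 s' c2 t2 s2)
  from exec_Seq.prems obtain u1 u2 m where
    u: "u = u1 + u2" "exec d c1 s u1 m" "exec d c2 m u2 s''"
    by (rule exec_SeqE)
  from exec_Seq.IH(1)[OF u(2)] have m: "u1 = t1" "m = s'" by simp_all
  from exec_Seq.IH(2)[OF u(3)[unfolded m(2)]] show ?case by (simp add: u(1) m(1))
next
  case exec_CondT
  from exec_CondT.prems show ?case
    by (rule exec_CondE) (use exec_CondT.hyps in \<open>auto dest: exec_CondT.IH\<close>)
next
  case exec_CondF
  from exec_CondF.prems show ?case
    by (rule exec_CondE) (use exec_CondF.hyps in \<open>auto dest: exec_CondF.IH\<close>)
next
  case exec_WhileF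
  from exec_WhileF.prems show ?case
    by (rule exec_WhileE) (use exec_WhileF.hyps in auto)
next
  case (exec_WhileT b s c t1 s' t2 s2)
  from exec_WhileT.prems exec_WhileT.hyps(1) obtain u1 u2 m where
    u: "u = 1 + btime b + u1 + u2" "exec d c s u1 m" "exec d (While b c) m u2 s''"
    by (blast elim: exec_WhileE)
  from exec_WhileT.IH(1)[OF u(2)] have m: "u1 = t1" "m = s'" by simp_all
  from exec_WhileT.IH(2)[OF u(3)[unfolded m(2)]] show ?case by (simp add: u(1) m(1))
next
  case exec_Interval
  from exec_Interval.prems show ?case
    by (rule exec_DecideE) (use exec_Interval.hyps in \<open>auto dest: exec_Interval.IH\<close>)
next
  case exec_Smaller
  from exec_Smaller.prems show ?case
    by (rule exec_DecideE) (use exec_Smaller.hyps in \<open>auto dest: exec_Smaller.IH\<close>)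
next
  case exec_Larger
  from exec_Larger.prems show ?case
    by (rule exec_DecideE) (use exec_Larger.hyps in \<open>auto dest: exec_Larger.IH\<close>)
qed

text \<open>
  Inputs \<open>\<epsilon>, \<alpha>, \<beta>\<close> are placed in registers 0, 1, 2; the output interval \<open>[lo, hi]\<close> is read off
  registers 1 and 2.
\<close>

definition computes_interval ::
  "com \<Rightarrow> (real \<Rightarrow> real \<Rightarrow> answer \<times> real) \<Rightarrow> real \<Rightarrow> real \<Rightarrow> real \<Rightarrow> real \<Rightarrow> real \<Rightarrow> real \<Rightarrow> bool"
  where
  "computes_interval prog d \<epsilon> \<alpha> \<beta> lo hi t \<longleftrightarrow>
    (\<exists>s'. exec d prog ((\<lambda>_. 0)(0 := \<epsilon>, 1 := \<alpha>, 2 := \<beta>)) t s' \<and> lo = s' 1 \<and> hi = s' 2)"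

end

theory Submission
  imports Defs
begin

text \<open>
  One call at the geometric mean \<open>r = sqrt (lo * hi)\<close> with parameter \<open>q \<le> sqrt (hi / lo)\<close>
  replaces the spread of the current interval by at most its square root, whatever the answer is.
  With \<open>q = 2\<close>, the double logarithm of the spread drops by 1 per call, so that
  \<open>log log (\<beta> / \<alpha>)\<close> calls reduce the spread to 4. From then on \<open>q = sqrt (hi / lo) = 1 + \<tau>\<close>
  is used as long as \<open>\<tau> > \<epsilon>\<close>, followed by one call with \<open>q = 1 + \<epsilon>\<close>: for
  smaller \<open>q\<close>, \<open>T(n, q)\<close> need not be \<open>O(T(n, 1 + \<epsilon>))\<close>. Passing to the square root at least
  halves \<open>\<tau>\<close>, so by stability the times of these calls are dominated by a geometric series with
  quotient \<open>2 powr - \<kappa>\<close> whose last term is \<open>O(T(n, 1 + \<epsilon>))\<close>.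
\<close>

section \<open>The program and its invariant\<close>

text \<open>Register 4 saves the value of \<open>q\<close>, which may depend on register 1 that the call overwrites.\<close>

definition bisect :: "aexp \<Rightarrow> com" where
  "bisect q =
     Seq (Assign 3 (Sqrt (Times (Reg 1) (Reg 2))))
    (Seq (Assign 4 q)
         (Decide (Reg 3) (Reg 4) 1
            (Assign 2 (Times (Reg 4) (Reg 1)))
            (Assign 2 (Reg 3))
            (Assign 1 (Reg 3))))"

text \<open>Above spread 4 the square root of the spread exceeds 2, so a call with parameter 2
  leaves at most that square root, whatever the answer.\<close>

definition coarse :: com where
  "coarse = While (Less (Times (Num 4) (Reg 1)) (Reg 2)) (bisect (Num 2))"

abbreviation one_plus_eps :: aexp where
  "one_plus_eps \<equiv> Plus (Num 1) (Reg 0)"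

text \<open>The guard means \<open>sqrt (hi / lo) > 1 + \<epsilon>\<close>, that is, \<tau> >
  \<epsilon>. Once it fails, a single call with parameter \<open>1 + \<epsilon>\<close> reaches
  spread \<open>1 + \<epsilon>\<close>.\<close>

definition fine :: com where
  "fine = While (Less (Times (Times one_plus_eps one_plus_eps) (Reg 1)) (Reg 2))
            (bisect (Sqrt (Divide (Reg 2) (Reg 1))))"

definition approximation_prog :: com where
  "approximation_prog = Seq coarse (Seq fine (bisect one_plus_eps))"

text \<open>Invariant of all three phases: register 0 keeps \<epsilon> for later guards, and the
  positive left endpoint makes \<open>s 2 / s 1\<close> a genuine spread.\<close>

definition encloses :: "real \<Rightarrow> real \<Rightarrow> state \<Rightarrow> bool" where
  "encloses v \<epsilon> s \<longleftrightarrow> s 0 = \<epsilon> \<and> 0 < s 1 \<and> s 1 \<le> v \<and> v \<le> s 2"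

abbreviation width :: "state \<Rightarrow> real" where
  "width s \<equiv> spread (s 1) (s 2)"

lemma less_width_iff: "encloses v \<epsilon> s \<Longrightarrow> c < width s \<longleftrightarrow> c * s 1 < s 2"
  by (simp add: encloses_def spread_def pos_less_divide_eq)

section \<open>Cost of loops, and the double logarithm\<close>

text \<open>Every iteration lowers the potential by at least 1, so the potential also gives termination.\<close>

lemma exec_While_potential:
  fixes \<Phi> :: "state \<Rightarrow> real"
  assumes btime: "0 \<le> btime b"
    and step: "\<And>s. I s \<Longrightarrow> bval b s \<Longrightarrow>
      \<exists>t s'. exec d c s t s' \<and> 0 \<le> t \<and> I s' \<and> 1 + btime b + t + \<Phi> s' \<le> \<Phi> s"
    and exit: "\<And>s. I s \<Longrightarrow> \<not> bval b s \<Longrightarrow> 1 + btime b \<le> \<Phi> s"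
    and nonneg: "\<And>s. I s \<Longrightarrow> 0 \<le> \<Phi> s"
    and "I s"
  shows "\<exists>t s'. exec d (While b c) s t s' \<and> I s' \<and> \<not> bval b s' \<and> t \<le> \<Phi> s"
proof -
  \<comment> \<open>The induction runs over a natural bound \<open>k\<close> of the real potential.
    An iteration costs at least 1, so none fits when \<open>k = 0\<close>, and each one lowers the
    bound by 1.\<close>
  have "\<exists>t s'. exec d (While b c) s t s' \<and> I s' \<and> \<not> bval b s' \<and> t \<le> \<Phi> s"
    if "I s" "\<Phi> s \<le> real k" for k s
    using that
  proof (induction k arbitrary: s)
    case 0
    have "\<not> bval b s"
    proof
      assume "bval b s"
      from step[OF \<open>I s\<close> this] obtain t s' where
        "0 \<le> t" "I s'" "1 + btime b + t + \<Phi> s' \<le> \<Phi> s" by blast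
      with nonneg[of s'] btime 0 show False by simp
    qed
    then show ?case using exec_WhileF exit 0 by blast
  next
    case (Suc k)
    show ?case
    proof (cases "bval b s")
      case False
      then show ?thesis using exec_WhileF exit Suc.prems by blast
    next
      case True
      from step[OF \<open>I s\<close> this] obtain t s' where
        s': "exec d c s t s'" "0 \<le> t" "I s'" "1 + btime b + t + \<Phi> s' \<le> \<Phi> s" by blast
      then have "\<Phi> s' \<le> real k" using btime Suc.prems by simp
      from Suc.IH[OF s'(3) this] obtain t' s'' where
        s'': "exec d (While b c) s' t' s''" "I s''" "\<not> bval b s''" "t' \<le> \<Phi> s'" by blast
      have "exec d (While b c) s (1 + btime b + t + t') s''"
        using True s'(1) s''(1) by (rule exec_WhileT)
      moreover have "1 + btime b + t + t' \<le> \<Phi> s" using s'(4) s''(4) by simp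
      ultimately show ?thesis using s''(2,3) by blast
    qed
  qed
  moreover obtain k where "\<Phi> s \<le> real k" using real_arch_simple by blast
  ultimately show ?thesis using \<open>I s\<close> by blast
qed

text \<open>Squaring \<open>y\<close> doubles the inner logarithm, and the outer logarithm turns the
  factor 2 into a summand 1.\<close>

lemma log_log_sqrt:
  assumes "4 < y" "y \<le> sqrt x"
  shows "log 2 (log 2 y) + 1 \<le> log 2 (log 2 x)"
proof -
  have "4 < sqrt x" using assms by simp
  then have x: "0 < x" using real_sqrt_gt_0_iff by fastforce
  have y: "0 < log 2 y" using assms by simp
  have "y\<^sup>2 \<le> (sqrt x)\<^sup>2" using assms by (intro power_mono) auto
  then have "log 2 (y\<^sup>2) \<le> log 2 x" using assms x by simp
  then have *: "2 * log 2 y \<le> log 2 x" using assms by (simp add: log_nat_power)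
  have "log 2 (log 2 y) + 1 = log 2 (2 * log 2 y)" using y by (simp add: log_mult)
  also have "\<dots> \<le> log 2 (log 2 x)" using * y by simp
  finally show ?thesis .
qed

text \<open>As \<open>log 2 4 = 2\<close>, the outer logarithm is at least 1. This pays for the call
  that brings the spread down to at most 4.\<close>

lemma one_le_log_log:
  assumes "4 < x" shows "1 \<le> log 2 (log 2 (x::real))"
proof -
  have "log 2 (2^2) \<le> log 2 x" using assms by simp
  then have "2 \<le> log 2 x" by (subst (asm) log_nat_power) auto
  then show ?thesis by (subst le_log_iff) auto
qed

section \<open>A single decider call\<close>

text \<open>The view for one fixed input: \<open>d\<close>, \<open>v\<close> and \<open>U\<close>
  stand for \<open>D P\<close>, \<open>f P\<close> and \<open>T n\<close>.\<close>

locale timed_decider =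
  fixes d :: "real \<Rightarrow> real \<Rightarrow> answer \<times> real" and v t\<^sub>0 :: real and U :: "real \<Rightarrow> real"
  assumes v_pos: "0 < v" and t0_pos: "0 < t\<^sub>0"
    and correct: "0 < r \<Longrightarrow> 1 < q \<Longrightarrow> correct_answer v r q (fst (d r q))"
    and time_ge: "0 < r \<Longrightarrow> 1 < q \<Longrightarrow> t\<^sub>0 \<le> snd (d r q)"
    and time_le: "0 < r \<Longrightarrow> 1 < q \<Longrightarrow> snd (d r q) \<le> U q"
begin

lemma U_ge: "1 < q \<Longrightarrow> t\<^sub>0 \<le> U q"
  using time_ge[of 1 q] time_le[of 1 q] by simp

lemma U_pos: "1 < q \<Longrightarrow> 0 < U q"
  using U_ge[of q] t0_pos by simp

text \<open>At most 34 units of other work are charged to each call; they are absorbed into its time bound.\<close>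

definition A :: real where
  "A = 1 + 34 / t\<^sub>0"

lemma A_ge_1: "1 \<le> A"
  using t0_pos by (simp add: A_def)

lemma overhead:
  assumes "1 < q" "k \<le> 34"
  shows "k + U q \<le> A * U q"
proof -
  have "k \<le> 34 / t\<^sub>0 * t\<^sub>0" using assms(2) t0_pos by simp
  also have "\<dots> \<le> 34 / t\<^sub>0 * U q"
    using U_ge[OF assms(1)] t0_pos by (intro mult_left_mono) auto
  finally show ?thesis by (simp add: A_def algebra_simps)
qed

text \<open>An \<open>Interval\<close> answer leaves spread exactly \<open>q\<close>; the other
  answers keep one side of the geometric mean, of spread \<open>sqrt (width s)\<close>. Register 3
  is overwritten before \<open>e\<close> is evaluated, hence the quantified premise on
  \<open>e\<close>. Of the 13 units, 6 belong to the two assignments and at most 7 to the work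
  around the call.\<close>

lemma exec_bisect:
  assumes s: "encloses v \<epsilon> s"
    and q: "1 < q" "\<And>x. aval e (s(3 := x)) = q"
    and atime: "0 \<le> atime e"
  shows "\<exists>t s'. exec d (bisect e) s t s' \<and> 0 \<le> t \<and> t \<le> 13 + atime e + U q \<and>
    encloses v \<epsilon> s' \<and> width s' \<le> max q (sqrt (width s))"
proof -
  define r where "r = sqrt (s 1 * s 2)"
  define s2 where "s2 = s(3 := r, 4 := q)"
  define c where "c = Decide (Reg 3) (Reg 4) 1
            (Assign 2 (Times (Reg 4) (Reg 1))) (Assign 2 (Reg 3)) (Assign 1 (Reg 3))"
  have pos: "0 < s 1" "0 < s 2" using s v_pos by (auto simp: encloses_def)
  then have r: "0 < r" by (simp add: r_def)
  have s2r: "s2 3 = r" "s2 4 = q" "s2 0 = s 0" "s2 1 = s 1" "s2 2 = s 2" by (simp_all add: s2_def)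
  have w: "spread (s 1) r = sqrt (width s)" "spread r (s 2) = sqrt (width s)"
    using pos by (simp_all add: spread_def r_def real_sqrt_mult real_sqrt_divide field_simps)
  obtain a u where au: "d r q = (a, u)" by (cases "d r q")
  have a: "correct_answer v r q a" using correct[OF r q(1)] au by simp
  have u: "t\<^sub>0 \<le> u" "u \<le> U q" using time_ge[OF r q(1)] time_le[OF r q(1)] au by simp_all
  have "\<exists>t s'. exec d c s2 t s' \<and> 0 \<le> t \<and> t \<le> 7 + U q \<and>
    encloses v \<epsilon> s' \<and> width s' \<le> max q (sqrt (width s))"
  proof (cases a)
    case (Interval x)
    have v: "x \<le> v" "v \<le> q * x" using a Interval by auto
    \<comment> \<open>A correct answer does not by itself promise a positive left endpoint;
      positivity comes from \<open>0 < v \<le> q * x\<close>.\<close>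
    then have "0 < q * x" using v_pos by simp
    then have x: "0 < x" using q(1) by (simp add: zero_less_mult_iff)
    have "exec d c s2 (1 + atime (Reg 3) + atime (Reg 4) + u + (1 + atime (Times (Reg 4) (Reg 1))))
      ((s2(1 := x))(2 := aval (Times (Reg 4) (Reg 1)) (s2(1 := x))))"
      unfolding c_def
      by (rule exec_Interval[OF _ _ _ exec_Assign]) (use r q au Interval in \<open>auto simp: s2r\<close>)
    moreover have "encloses v \<epsilon> ((s2(1 := x))(2 := aval (Times (Reg 4) (Reg 1)) (s2(1 := x))))"
      using x v s by (simp add: encloses_def s2_def)
    moreover have "width ((s2(1 := x))(2 := aval (Times (Reg 4) (Reg 1)) (s2(1 := x)))) = q"
      using x by (simp add: spread_def s2_def)
    ultimately show ?thesis using u t0_pos by - (rule exI, rule exI, rule conjI, assumption, auto)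
  next
    case Smaller
    have v: "v < r" using a Smaller by auto
    have "exec d c s2 (1 + atime (Reg 3) + atime (Reg 4) + u + (1 + atime (Reg 3)))
      (s2(2 := aval (Reg 3) s2))"
      unfolding c_def
      by (rule exec_Smaller[OF _ _ _ exec_Assign]) (use r q au Smaller in \<open>auto simp: s2r\<close>)
    moreover have "encloses v \<epsilon> (s2(2 := aval (Reg 3) s2))"
      using v s by (simp add: encloses_def s2_def)
    moreover have "width (s2(2 := aval (Reg 3) s2)) = sqrt (width s)"
      using w by (simp add: s2_def)
    ultimately show ?thesis using u t0_pos by - (rule exI, rule exI, rule conjI, assumption, auto)
  next
    case Larger
    have v: "r < v" using a Larger by auto
    have "exec d c s2 (1 + atime (Reg 3) + atime (Reg 4) + u + (1 + atime (Reg 3)))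
      (s2(1 := aval (Reg 3) s2))"
      unfolding c_def
      by (rule exec_Larger[OF _ _ _ exec_Assign]) (use r q au Larger in \<open>auto simp: s2r\<close>)
    moreover have "encloses v \<epsilon> (s2(1 := aval (Reg 3) s2))"
      using v r s by (simp add: encloses_def s2_def)
    moreover have "width (s2(1 := aval (Reg 3) s2)) = sqrt (width s)"
      using w by (simp add: s2_def)
    ultimately show ?thesis using u t0_pos by - (rule exI, rule exI, rule conjI, assumption, auto)
  qed
  then obtain t s' where t: "exec d c s2 t s'" "0 \<le> t" "t \<le> 7 + U q"
    "encloses v \<epsilon> s'" "width s' \<le> max q (sqrt (width s))" by blast
  have "exec d (Assign 3 (Sqrt (Times (Reg 1) (Reg 2)))) s 5 (s(3 := r))"
    using exec_Assign[of d 3 "Sqrt (Times (Reg 1) (Reg 2))" s] by (simp add: r_def)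
  moreover have "exec d (Assign 4 e) (s(3 := r)) (1 + atime e) s2"
    using exec_Assign[of d 4 e "s(3 := r)"] by (simp add: s2_def q(2))
  ultimately have "exec d (bisect e) s (5 + ((1 + atime e) + t)) s'"
    unfolding bisect_def c_def[symmetric] using t(1) by (blast intro: exec_Seq)
  then show ?thesis using t atime by - (rule exI, rule exI, rule conjI, assumption, auto)
qed

section \<open>Down to spread 4 with parameter 2\<close>

lemma exec_coarse:
  assumes "encloses v \<epsilon> s"
  shows "\<exists>t s'. exec d coarse s t s' \<and> encloses v \<epsilon> s' \<and> width s' \<le> 4 \<and>
    t \<le> A * U 2 * loglog (width s) + 6"
proof -
  \<comment> \<open>One unit of the double logarithm pays for one iteration; 6 is the cost of the
    final, failing guard. At spread at most 4 the value is set to 0, as the double logarithm may be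
    negative there.\<close>
  define \<Phi> where
    "\<Phi> s = A * U 2 * (if 4 < width s then log 2 (log 2 (width s)) else 0) + 6" for s
  let ?b = "Less (Times (Num 4) (Reg 1)) (Reg 2)"
  have AU: "0 < A * U 2" using A_ge_1 U_pos[of 2] by simp
  have bval: "bval ?b s \<longleftrightarrow> 4 < width s" if "encloses v \<epsilon> s" for s
    unfolding less_width_iff[OF that] by simp
  have nonneg: "6 \<le> \<Phi> s" for s
    using one_le_log_log[of "width s"] AU by (simp add: \<Phi>_def)
  have "\<exists>t s'. exec d (While ?b (bisect (Num 2))) s t s' \<and> encloses v \<epsilon> s' \<and> \<not> bval ?b s' \<and> t \<le> \<Phi> s"
  proof (rule exec_While_potential)
    fix s assume s: "encloses v \<epsilon> s" and "bval ?b s"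
    then have w: "4 < width s" using bval by blast
    have "2 < sqrt (width s)" using w real_less_rsqrt[of 2 "width s"] by simp
    with exec_bisect[OF s, of 2 "Num 2"] obtain t s' where
      t: "exec d (bisect (Num 2)) s t s'" "0 \<le> t" "t \<le> 14 + U 2" "encloses v \<epsilon> s'"
      "width s' \<le> sqrt (width s)" by auto
    have "1 + btime ?b + t \<le> A * U 2" using t(3) overhead[of 2 20] by simp
    \<comment> \<open>If the new spread is still above 4, the double logarithm drops by 1; otherwise
      all of it is released, which is at least 1.\<close>
    moreover have "A * U 2 * 1 \<le> \<Phi> s - \<Phi> s'"
      using w t(5) log_log_sqrt[of "width s'" "width s"] one_le_log_log[of "width s"] AU
      unfolding \<Phi>_def
      by (auto simp: right_diff_distrib[symmetric] simp del: mult_1_right intro!: mult_left_mono)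
    ultimately show "\<exists>t s'. exec d (bisect (Num 2)) s t s' \<and> 0 \<le> t \<and> encloses v \<epsilon> s' \<and>
        1 + btime ?b + t + \<Phi> s' \<le> \<Phi> s"
      using t by (intro exI[of _ t] exI[of _ s']) auto
  qed (use nonneg assms in \<open>auto intro: order_trans[OF _ nonneg]\<close>)
  then obtain t s' where t: "exec d coarse s t s'" "encloses v \<epsilon> s'" "\<not> bval ?b s'" "t \<le> \<Phi> s"
    unfolding coarse_def by blast
  moreover have "\<Phi> s \<le> A * U 2 * loglog (width s) + 6"
    using AU by (auto simp: \<Phi>_def loglog_def intro!: mult_left_mono)
  ultimately show ?thesis using bval[OF t(2)] by (intro exI[of _ t] exI[of _ s']) auto
qed

section \<open>From spread 4 to \<open>(1 + \<epsilon>)\<close> squared: the geometric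
  series\<close>

text \<open>Spread at most 4 gives \<tau> + 1 \<le> 2, so stability bounds the call with
  \<open>1 + \<tau>\<close> by \<open>U (1 + \<epsilon>) * 2 powr \<kappa> / c * (\<epsilon> /
  \<tau>) powr \<kappa>\<close>. As \<tau> at least halves each time, these bounds sum to a series
  of quotient \<open>2 powr - \<kappa>\<close>, with value
  \<open>1 + 1 / (2 powr \<kappa> - 1)\<close>.\<close>

lemma exec_fine:
  assumes \<epsilon>: "0 < \<epsilon>" and \<kappa>: "0 < \<kappa>" and c: "0 < c"
    and stable: "\<And>\<tau>. \<epsilon> < \<tau> \<Longrightarrow> c * (\<tau> / (\<epsilon> * (\<tau> + 1))) powr \<kappa> \<le> U (1 + \<epsilon>) / U (1 + \<tau>)"
    and s: "encloses v \<epsilon> s" "width s \<le> 4"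
  shows "\<exists>t s'. exec d fine s t s' \<and> encloses v \<epsilon> s' \<and> width s' \<le> (1 + \<epsilon>)\<^sup>2 \<and>
    t \<le> A * U (1 + \<epsilon>) * (2 powr \<kappa> / c * (1 + 1 / (2 powr \<kappa> - 1))) + 12"
proof -
  define W where "W = A * U (1 + \<epsilon>) * 2 powr \<kappa> / c"
  define M where "M = 1 / (2 powr \<kappa> - 1)"
  define \<tau> where "\<tau> s = sqrt (width s) - 1" for s
  define x where "x s = (\<epsilon> / \<tau> s) powr \<kappa>" for s
  \<comment> \<open>An iteration from \<open>s\<close> costs at most \<open>W * x s\<close>. Since
    \<open>x\<close> grows by a factor of at least \<open>2 powr \<kappa>\<close> and
    \<open>M * (2 powr \<kappa> - 1) = 1\<close>, the growth of \<open>M * x\<close> pays for it.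
    The summand \<open>1 + M\<close> keeps enough for the last iteration because
    \<open>x s \<le> 1\<close>; 12 is the final guard.\<close>
  define \<Phi> where
    "\<Phi> s = W * (if (1 + \<epsilon>)\<^sup>2 < width s then 1 + M - M * x s else 0) + 12" for s
  let ?b = "Less (Times (Times one_plus_eps one_plus_eps) (Reg 1)) (Reg 2)"
  let ?e = "Sqrt (Divide (Reg 2) (Reg 1))"
  have W: "0 < W" using A_ge_1 U_pos[of "1 + \<epsilon>"] c \<epsilon> by (simp add: W_def)
  have "2 powr 0 < 2 powr \<kappa>" using \<kappa> by (intro powr_less_mono) auto
  then have two: "0 < 2 powr \<kappa> - 1" by simp
  then have M: "0 < M" "M * (2 powr \<kappa> - 1) = 1" using \<kappa> by (simp_all add: M_def)
  have bval: "bval ?b s \<longleftrightarrow> (1 + \<epsilon>)\<^sup>2 < width s" if "encloses v \<epsilon> s" for s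
    using less_width_iff[OF that, of "(1 + \<epsilon>)\<^sup>2"] that
    by (simp add: encloses_def power2_eq_square)
  have \<tau>: "\<epsilon> < \<tau> s" if "(1 + \<epsilon>)\<^sup>2 < width s" for s
    using real_less_rsqrt[OF that] by (simp add: \<tau>_def)
  have x_le: "x s \<le> 1" if "(1 + \<epsilon>)\<^sup>2 < width s" for s
    using \<tau>[OF that] \<epsilon> \<kappa> unfolding x_def by (intro powr_le1) auto
  have Mx: "x s \<le> 1 + M - M * x s" if "(1 + \<epsilon>)\<^sup>2 < width s" for s
    using mult_left_mono[OF x_le[OF that], of "1 + M"] M(1) by (simp add: algebra_simps)
  have x_nonneg: "0 \<le> x s" for s by (simp add: x_def)
  have nonneg: "12 \<le> \<Phi> s" for s
    using order_trans[OF x_nonneg Mx, of s] W by (simp add: \<Phi>_def)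
  have "\<exists>t s'. exec d (While ?b (bisect ?e)) s t s' \<and> (encloses v \<epsilon> s' \<and> width s' \<le> 4) \<and>
    \<not> bval ?b s' \<and> t \<le> \<Phi> s"
  proof (rule exec_While_potential)
    fix s assume s: "encloses v \<epsilon> s \<and> width s \<le> 4" and "bval ?b s"
    then have w: "(1 + \<epsilon>)\<^sup>2 < width s" using bval by blast
    have \<tau>s: "\<epsilon> < \<tau> s" using \<tau>[OF w] .
    have q: "1 < sqrt (width s)" using \<tau>s \<epsilon> unfolding \<tau>_def by linarith
    have q2: "sqrt (width s) \<le> 2" using s real_sqrt_le_mono[of "width s" 4] by simp
    then have \<tau>2: "\<tau> s + 1 \<le> 2" by (simp add: \<tau>_def)
    from exec_bisect[OF conjunct1[OF s] q, of ?e] obtain t s' where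
      t: "exec d (bisect ?e) s t s'" "0 \<le> t" "t \<le> 17 + U (sqrt (width s))" "encloses v \<epsilon> s'"
      "width s' \<le> sqrt (width s)" by (auto simp: spread_def)
    have 4: "width s' \<le> 4" using t(5) q2 by simp
    have U: "0 < U (1 + \<tau> s)" using U_pos q by (simp add: \<tau>_def)
    have "U (1 + \<tau> s) * (c * (\<tau> s / (\<epsilon> * (\<tau> s + 1))) powr \<kappa>) \<le> U (1 + \<epsilon>)"
      using stable[OF \<tau>s] U by (simp add: pos_le_divide_eq mult.commute)
    moreover have "(\<tau> s / (\<epsilon> * 2)) powr \<kappa> \<le> (\<tau> s / (\<epsilon> * (\<tau> s + 1))) powr \<kappa>"
      using \<tau>s \<epsilon> \<kappa> \<tau>2 by (intro powr_mono2 divide_left_mono mult_left_mono) auto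
    then have "U (1 + \<tau> s) * (c * (\<tau> s / (\<epsilon> * 2)) powr \<kappa>)
      \<le> U (1 + \<tau> s) * (c * (\<tau> s / (\<epsilon> * (\<tau> s + 1))) powr \<kappa>)"
      using U c by (intro mult_left_mono) auto
    ultimately have "U (1 + \<tau> s) * (c * (\<tau> s / (\<epsilon> * 2)) powr \<kappa>) \<le> U (1 + \<epsilon>)" by simp
    \<comment> \<open>Up to \<open>2 powr \<kappa>\<close>, \<open>x s\<close> is the reciprocal of
      the stability factor, so multiplying by it isolates \<open>U (1 + \<tau> s)\<close>.\<close>
    moreover have "(\<tau> s / (\<epsilon> * 2)) powr \<kappa> * (2 powr \<kappa> * x s) = 1"
      using \<tau>s \<epsilon> by (simp add: x_def powr_mult[symmetric])
    ultimately have "U (1 + \<tau> s) * c \<le> U (1 + \<epsilon>) * (2 powr \<kappa> * x s)"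
      using mult_right_mono[of "U (1 + \<tau> s) * (c * (\<tau> s / (\<epsilon> * 2)) powr \<kappa>)" "U (1 + \<epsilon>)"
          "2 powr \<kappa> * x s"] x_nonneg[of s] by (simp add: mult.assoc)
    then have "U (1 + \<tau> s) \<le> U (1 + \<epsilon>) * 2 powr \<kappa> * x s / c"
      using c by (simp add: pos_le_divide_eq mult.assoc)
    from mult_left_mono[OF this, of A] have "A * U (1 + \<tau> s) \<le> W * x s"
      using A_ge_1 by (simp add: W_def mult.assoc)
    moreover have "1 + btime ?b + t \<le> A * U (1 + \<tau> s)"
      using t(3) overhead[OF q, of 29] by (simp add: \<tau>_def)
    moreover have "W * x s \<le> \<Phi> s - \<Phi> s'"
    proof (cases "(1 + \<epsilon>)\<^sup>2 < width s'")
      \<comment> \<open>The loop ends here, and the whole remaining potential covers the last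
        call.\<close>
      case False
      then show ?thesis using w Mx[OF w] W by (simp add: \<Phi>_def)
    next
      case True
      have \<tau>s': "\<epsilon> < \<tau> s'" using \<tau>[OF True] .
      \<comment> \<open>The left side is the new spread, the right side the square root of the old
        one. Expanding and dropping the square of \<open>\<tau> s'\<close> yields the halving of
        \<tau>.\<close>
      have "(1 + \<tau> s')\<^sup>2 \<le> 1 + \<tau> s"
        using t(5) True by (simp add: \<tau>_def order_trans[OF zero_le_power2 less_imp_le])
      then have "2 * \<tau> s' \<le> \<tau> s"
        using zero_le_power2[of "\<tau> s'"] unfolding power2_sum one_power2 mult_1_right
        by linarith
      then have "2 * (\<epsilon> / \<tau> s) \<le> \<epsilon> / \<tau> s'"
        using \<tau>s \<tau>s' \<epsilon> by (simp add: field_simps)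
      then have "(2 * (\<epsilon> / \<tau> s)) powr \<kappa> \<le> x s'"
        unfolding x_def using \<tau>s \<epsilon> \<kappa> by (intro powr_mono2) auto
      then have "2 powr \<kappa> * x s \<le> x s'"
        unfolding x_def by (subst (asm) powr_mult) (use \<tau>s \<epsilon> in auto)
      from mult_left_mono[OF this, of M] have "M * (2 powr \<kappa> - 1) * x s \<le> M * x s' - M * x s"
        using M(1) by (simp add: algebra_simps)
      then have "x s \<le> M * x s' - M * x s" by (simp add: M(2))
      from mult_left_mono[OF this, of W] show ?thesis
        using True w W by (simp add: \<Phi>_def algebra_simps)
    qed
    ultimately show "\<exists>t s'. exec d (bisect ?e) s t s' \<and> 0 \<le> t \<and> (encloses v \<epsilon> s' \<and> width s' \<le> 4) \<and>
        1 + btime ?b + t + \<Phi> s' \<le> \<Phi> s"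
      using t 4 by (intro exI[of _ t] exI[of _ s']) auto
  qed (use nonneg s in \<open>auto intro: order_trans[OF _ nonneg]\<close>)
  then obtain t s' where t: "exec d fine s t s'" "encloses v \<epsilon> s'" "\<not> bval ?b s'" "t \<le> \<Phi> s"
    unfolding fine_def by blast
  moreover have "\<Phi> s \<le> W * (1 + M) + 12"
    using W M(1) x_nonneg[of s] by (auto simp: \<Phi>_def intro!: mult_left_mono)
  moreover have "W * (1 + M) = A * U (1 + \<epsilon>) * (2 powr \<kappa> / c * (1 + 1 / (2 powr \<kappa> - 1)))"
    by (simp add: W_def M_def)
  ultimately show ?thesis using bval[OF t(2)] by (intro exI[of _ t] exI[of _ s']) auto
qed

section \<open>The three phases together\<close>

lemma exec_approximation_prog:
  assumes \<epsilon>: "0 < \<epsilon>" and \<kappa>: "0 < \<kappa>" and c: "0 < c"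
    and stable: "\<And>\<tau>. \<epsilon> < \<tau> \<Longrightarrow> c * (\<tau> / (\<epsilon> * (\<tau> + 1))) powr \<kappa> \<le> U (1 + \<epsilon>) / U (1 + \<tau>)"
    and s: "encloses v \<epsilon> s"
  shows "\<exists>t s'. exec d approximation_prog s t s' \<and> encloses v \<epsilon> s' \<and> width s' \<le> 1 + \<epsilon> \<and>
    t \<le> A * (1 + 2 powr \<kappa> / c * (1 + 1 / (2 powr \<kappa> - 1))) * (U (1 + \<epsilon>) + U 2 * loglog (width s))"
proof -
  define K where "K = 2 powr \<kappa> / c * (1 + 1 / (2 powr \<kappa> - 1))"
  have "2 powr 0 < 2 powr \<kappa>" using \<kappa> by (intro powr_less_mono) auto
  then have K: "0 \<le> K" using c by (simp add: K_def)
  from exec_coarse[OF s] obtain t1 s1 where 1: "exec d coarse s t1 s1" "encloses v \<epsilon> s1"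
    "width s1 \<le> 4" "t1 \<le> A * U 2 * loglog (width s) + 6" by blast
  from exec_fine[OF \<epsilon> \<kappa> c stable 1(2,3)] obtain t2 s2 where 2: "exec d fine s1 t2 s2"
    "encloses v \<epsilon> s2" "width s2 \<le> (1 + \<epsilon>)\<^sup>2" "t2 \<le> A * U (1 + \<epsilon>) * K + 12"
    unfolding K_def by blast
  \<comment> \<open>Hence the maximum of parameter and square root after the last call is
    \<open>1 + \<epsilon>\<close>.\<close>
  have "sqrt (width s2) \<le> 1 + \<epsilon>" using \<epsilon> real_sqrt_le_mono[OF 2(3)] by simp
  with exec_bisect[OF 2(2), of "1 + \<epsilon>" one_plus_eps] 2(2) \<epsilon>
  obtain t3 s3 where 3: "exec d (bisect one_plus_eps) s2 t3 s3" "encloses v \<epsilon> s3"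
    "width s3 \<le> 1 + \<epsilon>" "t3 \<le> 16 + U (1 + \<epsilon>)"
    by (auto simp: encloses_def)
  have "exec d approximation_prog s (t1 + (t2 + t3)) s3"
    unfolding approximation_prog_def using 1(1) 2(1) 3(1) by (blast intro: exec_Seq)
  moreover have "t1 + (t2 + t3) \<le> A * (1 + K) * (U (1 + \<epsilon>) + U 2 * loglog (width s))"
  proof -
    \<comment> \<open>The two failing guards cost 6 and 12, the last bisection 16 besides its call.
      These 34 units are all charged to that call.\<close>
    have "t1 + (t2 + t3) \<le> A * U 2 * loglog (width s) + A * U (1 + \<epsilon>) * K + A * U (1 + \<epsilon>)"
      using 1(4) 2(4) 3(4) overhead[of "1 + \<epsilon>" 34] \<epsilon> by simp
    \<comment> \<open>A nonnegative term is added so that \<open>1 + K\<close> factors out of both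
      summands.\<close>
    also have "\<dots> \<le> \<dots> + A * U 2 * loglog (width s) * K"
      using A_ge_1 U_pos[of 2] K by (simp add: loglog_def)
    finally show ?thesis by (simp add: algebra_simps)
  qed
  ultimately show ?thesis using 3 unfolding K_def by blast
qed

end

theorem theorem6p4:
  "\<exists>prog :: com.
     \<forall>(T :: nat \<Rightarrow> real \<Rightarrow> real) (t\<^sub>0 :: real). stable T \<and> 0 < t\<^sub>0 \<longrightarrow>
       (\<exists>C>0. \<forall>(f :: 'a set \<Rightarrow> real) (D :: 'a procedure) (P :: 'a set) (n :: nat)
                (\<epsilon> :: real) (\<alpha> :: real) (\<beta> :: real).
          (\<forall>Q. finite Q \<longrightarrow> 0 \<le> f Q) \<and>
          finite P \<and> card P = n \<and>
          0 < \<epsilon> \<and> \<epsilon> < 1 \<and> 0 < \<alpha> \<and> \<alpha> < \<beta> \<and> f P \<in> {\<alpha>..\<beta>} \<and>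
          (\<forall>\<tau>>0. decider_for D P (f P) (1 + \<tau>)) \<and>
          (\<forall>r \<tau>. 0 < r \<and> 0 < \<tau> \<longrightarrow>
             t\<^sub>0 \<le> snd (D P r (1 + \<tau>)) \<and> snd (D P r (1 + \<tau>)) \<le> T n (1 + \<tau>)) \<longrightarrow>
          (\<exists>lo hi t. computes_interval prog (D P) \<epsilon> \<alpha> \<beta> lo hi t \<and>
             0 < lo \<and> lo \<le> hi \<and> f P \<in> {lo..hi} \<and> spread lo hi \<le> 1 + \<epsilon> \<and>
             t \<le> C * (T n (1 + \<epsilon>) + T n 2 * loglog (\<beta> / \<alpha>))))"
proof (intro exI[of _ approximation_prog] allI impI)
  fix T :: "nat \<Rightarrow> real \<Rightarrow> real" and t\<^sub>0 :: real
  assume asm: "stable T \<and> 0 < t\<^sub>0"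
  then obtain \<kappa> c where \<kappa>: "0 < \<kappa>" and c: "0 < c"
    and st: "\<And>n \<tau> \<epsilon>'. 0 < \<epsilon>' \<Longrightarrow> \<epsilon>' < \<tau> \<Longrightarrow>
      c * (\<tau> / (\<epsilon>' * (\<tau> + 1))) powr \<kappa> \<le> T n (1 + \<epsilon>') / T n (1 + \<tau>)"
    unfolding stable_def by blast
  \<comment> \<open>Stability gives \<kappa> and \<open>c\<close> uniformly in \<open>n\<close>, so
    \<open>C\<close> depends only on \<open>T\<close> and \<open>t\<^sub>0\<close> and is fixed
    before the input.\<close>
  define C where "C = (1 + 34 / t\<^sub>0) * (1 + 2 powr \<kappa> / c * (1 + 1 / (2 powr \<kappa> - 1)))"
  have "2 powr 0 < 2 powr \<kappa>" using \<kappa> by (intro powr_less_mono) auto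
  then have "0 < C" using asm c unfolding C_def by (intro mult_pos_pos add_pos_nonneg) auto
  show "\<exists>C>0. \<forall>(f :: 'a set \<Rightarrow> real) (D :: 'a procedure) (P :: 'a set) (n :: nat)
                (\<epsilon> :: real) (\<alpha> :: real) (\<beta> :: real).
          (\<forall>Q. finite Q \<longrightarrow> 0 \<le> f Q) \<and>
          finite P \<and> card P = n \<and>
          0 < \<epsilon> \<and> \<epsilon> < 1 \<and> 0 < \<alpha> \<and> \<alpha> < \<beta> \<and> f P \<in> {\<alpha>..\<beta>} \<and>
          (\<forall>\<tau>>0. decider_for D P (f P) (1 + \<tau>)) \<and>
          (\<forall>r \<tau>. 0 < r \<and> 0 < \<tau> \<longrightarrow>
             t\<^sub>0 \<le> snd (D P r (1 + \<tau>)) \<and> snd (D P r (1 + \<tau>)) \<le> T n (1 + \<tau>)) \<longrightarrow>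
          (\<exists>lo hi t. computes_interval approximation_prog (D P) \<epsilon> \<alpha> \<beta> lo hi t \<and>
             0 < lo \<and> lo \<le> hi \<and> f P \<in> {lo..hi} \<and> spread lo hi \<le> 1 + \<epsilon> \<and>
             t \<le> C * (T n (1 + \<epsilon>) + T n 2 * loglog (\<beta> / \<alpha>)))"
  proof (rule exI[of _ C], rule conjI[OF \<open>0 < C\<close>], intro allI impI, elim conjE)
    fix f :: "'a set \<Rightarrow> real" and D :: "'a procedure" and P :: "'a set" and n :: nat
      and \<epsilon> \<alpha> \<beta> :: real
    assume \<epsilon>: "0 < \<epsilon>" and \<alpha>: "0 < \<alpha>" and v: "f P \<in> {\<alpha>..\<beta>}"
      and dec: "\<forall>\<tau>>0. decider_for D P (f P) (1 + \<tau>)"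
      and time: "\<forall>r \<tau>. 0 < r \<and> 0 < \<tau> \<longrightarrow>
             t\<^sub>0 \<le> snd (D P r (1 + \<tau>)) \<and> snd (D P r (1 + \<tau>)) \<le> T n (1 + \<tau>)"
    interpret timed_decider "D P" "f P" t\<^sub>0 "T n"
    proof
      show "0 < f P" "0 < t\<^sub>0" using \<alpha> v asm by auto
      fix r q :: real assume "0 < r" "1 < q"
      then show "correct_answer (f P) r q (fst (D P r q))"
        "t\<^sub>0 \<le> snd (D P r q)" "snd (D P r q) \<le> T n q"
        using dec[rule_format, of "q - 1"] time[rule_format, of r "q - 1"]
        by (simp_all add: decider_for_def)
    qed
    let ?s = "(\<lambda>_. 0)(0 := \<epsilon>, 1 := \<alpha>, 2 := \<beta>) :: state"
    have "encloses (f P) \<epsilon> ?s" using \<alpha> v by (simp add: encloses_def)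
    from exec_approximation_prog[OF \<epsilon> \<kappa> c st[OF \<epsilon>] this] obtain t s' where
      t: "exec (D P) approximation_prog ?s t s'" "encloses (f P) \<epsilon> s'" "width s' \<le> 1 + \<epsilon>"
      "t \<le> C * (T n (1 + \<epsilon>) + T n 2 * loglog (\<beta> / \<alpha>))"
      by (auto simp: A_def C_def spread_def)
    then show "\<exists>lo hi t. computes_interval approximation_prog (D P) \<epsilon> \<alpha> \<beta> lo hi t \<and>
             0 < lo \<and> lo \<le> hi \<and> f P \<in> {lo..hi} \<and> spread lo hi \<le> 1 + \<epsilon> \<and>
             t \<le> C * (T n (1 + \<epsilon>) + T n 2 * loglog (\<beta> / \<alpha>))"
      unfolding computes_interval_def
      by (intro exI[of _ "s' 1"] exI[of _ "s' 2"] exI[of _ t]) (auto simp: encloses_def)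
  qed
qed

end
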